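(* Let $X$ be a metrizable space, let $Y$ be a completely metrizable space, let $A\subseteq X$, and let $f:A\to Y$ be a continuous mapping. Then there exists a Lebesgue class one mapping $g:X\to Y$ such that $g|_A=f$.
   Context: For topological spaces $X$ and $Y$, a mapping $g:X\to Y$ is a Lebesgue class one mapping if for every open set $V\subseteq Y$ the preimage $g^{-1}(V)$ is an $F_\sigma$-set in $X$. The set $A$ carries the subspace topology.
   Formalization: The formal statement additionally assumes that X is empty whenever Y is empty; without this the claim fails for Y empty, X nonempty and A empty, since then there is no mapping from X to Y at all. *)

theory Defs
  imports "HOL-Analysis.Analysis"
begin

definition lebesgue_class_one_map :: "'a topology \<Rightarrow> 'b topology \<Rightarrow> ('a \<Rightarrow> 'b) \<Rightarrow> bool" where
  "lebesgue_class_one_map X Y g \<longleftrightarrow>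
     g \<in> topspace X \<rightarrow> topspace Y \<and>
     (\<forall>V. openin Y V \<longrightarrow> fsigma_in X {x \<in> topspace X. g x \<in> V})"

end

theory Submission
  imports Defs
begin

text \<open>
  The extension is a uniform limit of maps whose preimages of \<^emph>\<open>arbitrary\<close> sets are
  \<open>F\<^sub>\<sigma>\<close>. Fix a complete metric on \<^term>\<open>Y\<close>, a well-order of its points, and radii \<open>\<epsilon>\<^sub>n\<close>
  decreasing to zero. For a point \<open>y\<close> of \<^term>\<open>Y\<close> let \<open>U n y\<close> be the open set of those \<open>x\<close> having
  a neighbourhood \<open>W\<close> with \<open>f(W \<inter> A)\<close> inside the \<open>\<epsilon>\<^sub>n\<close>-ball about \<open>y\<close>, and let \<open>h n x\<close> be the
  least \<open>y\<close> with \<open>x \<in> U n y\<close>, where there is one. The domain of \<open>h n\<close> contains \<^term>\<open>A\<close> by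
  continuity of \<^term>\<open>f\<close>, and there \<open>h n\<close> is \<open>\<epsilon>\<^sub>n\<close>-close to \<^term>\<open>f\<close>.

  Two facts make this work. The first is \<open>fsigma_in_minim_vimage\<close>: a map choosing the least
  index of an open set containing a point has \<open>F\<^sub>\<sigma>\<close> preimages, because the piece on which a given
  index is chosen is exhausted by closed sets that are uniformly separated for different indices,
  so that even huge unions of them are closed. The second is that \<open>h n x\<close> and \<open>h m x\<close> are
  automatically close, even for \<open>x\<close> outside \<^term>\<open>A\<close>: either \<open>x\<close> is in the closure of \<^term>\<open>A\<close>, and
  both are close to \<open>f a\<close> for some \<open>a \<in> A\<close> near \<open>x\<close>, or \<open>x\<close> has a neighbourhood missing \<^term>\<open>A\<close>,
  and both are the least point of \<^term>\<open>Y\<close>.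

  The domains decrease with \<open>n\<close>. Letting \<open>g n x\<close> be the last of \<open>h 0 x, ..., h n x\<close> that is
  defined, or a base point of \<^term>\<open>Y\<close> if none is, gives total maps that are uniformly Cauchy, and
  their limit agrees with \<^term>\<open>f\<close> on \<^term>\<open>A\<close>. That the limit is of class one is
  \<open>lebesgue_class_one_map_uniform_limit\<close>.
\<close>

section \<open>Choosing the least index of an open cover\<close>

text \<open>
  For a radius \<open>\<epsilon>\<close>, the points that choose the index \<open>i\<close> and whose \<open>\<epsilon>\<close>-ball lies in \<^term>\<open>U i\<close>
  form a set \<open>P i\<close>. Points of \<open>P i\<close> and \<open>P j\<close> at distance less than \<open>\<epsilon>\<close> lie in each other's open
  sets, so minimality gives \<open>i = j\<close>. Hence a point adherent to a union of these sets is
  adherent to a single \<open>P i\<close>, and both conditions defining \<open>P i\<close> survive passage to the limit.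
\<close>
lemma (in Metric_space) closedin_Union_minimal_index_core:
  assumes "antisym r" and U: "\<And>i. i \<in> I \<Longrightarrow> openin mtopology (U i)" and "0 < e" and "S \<subseteq> I"
  shows "closedin mtopology
    (\<Union>i\<in>S. {x \<in> M. mball x e \<subseteq> U i \<and> (\<forall>j\<in>I. x \<in> U j \<longrightarrow> (i, j) \<in> r)})"
proof -
  define P where "P = (\<lambda>i. {x \<in> M. mball x e \<subseteq> U i \<and> (\<forall>j\<in>I. x \<in> U j \<longrightarrow> (i, j) \<in> r)})"
  have sep: "i = j"
    if "i \<in> S" "j \<in> S" "u \<in> P i" "v \<in> P j" "d u v < e" for i j u v
  proof -
    have "v \<in> mball u e" "u \<in> mball v e"
      using that by (auto simp: P_def commute)
    then have "v \<in> U i" "u \<in> U j"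
      using that by (auto simp: P_def)
    then have "(i, j) \<in> r" "(j, i) \<in> r"
      using that \<open>S \<subseteq> I\<close> by (auto simp: P_def)
    with \<open>antisym r\<close> show ?thesis
      by (simp add: antisymD)
  qed
  have limit: "x \<in> (\<Union>i\<in>S. P i)"
    if "x \<in> M" and near: "\<And>t. t > 0 \<Longrightarrow> \<exists>u\<in>(\<Union>i\<in>S. P i). d x u < t" for x
  proof -
    obtain i u where i: "i \<in> S" "u \<in> P i" "d x u < e / 2"
      using near[of "e / 2"] \<open>0 < e\<close> by auto
    have near_i: "\<exists>v\<in>P i. d x v < t" if "t > 0" for t
    proof -
      obtain k v where k: "k \<in> S" "v \<in> P k" "d x v < min t (e / 2)"
        using near[of "min t (e / 2)"] \<open>0 < e\<close> \<open>t > 0\<close> by auto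
      have "d u v \<le> d x u + d x v"
        using triangle''[of u x v] i k \<open>x \<in> M\<close> by (auto simp: P_def commute)
      with i k have "i = k"
        by (intro sep[of i k u v]) auto
      with k show ?thesis by auto
    qed
    have "mball x e \<subseteq> U i"
    proof
      fix y assume y: "y \<in> mball x e"
      then obtain v where v: "v \<in> P i" "d x v < e - d x y"
        using near_i[of "e - d x y"] by auto
      have "d v y \<le> d x v + d x y"
        using triangle''[of v x y] v y by (auto simp: P_def commute)
      with v y have "y \<in> mball v e"
        by (auto simp: P_def)
      with v show "y \<in> U i"
        by (auto simp: P_def)
    qed
    moreover have "(i, j) \<in> r" if "j \<in> I" "x \<in> U j" for j
    proof -
      obtain t where "t > 0" "mball x t \<subseteq> U j"
        using U[OF \<open>j \<in> I\<close>] \<open>x \<in> U j\<close> unfolding openin_mtopology by blast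
      moreover obtain v where "v \<in> P i" "d x v < t"
        using near_i[OF \<open>t > 0\<close>] by auto
      ultimately show ?thesis
        using \<open>x \<in> M\<close> \<open>j \<in> I\<close> by (force simp: P_def)
    qed
    ultimately show ?thesis
      using \<open>x \<in> M\<close> \<open>i \<in> S\<close> by (auto simp: P_def)
  qed
  have sub: "(\<Union>i\<in>S. P i) \<subseteq> M"
    by (auto simp: P_def)
  have "closedin mtopology (\<Union>i\<in>S. P i)"
    unfolding closedin_metric
  proof (intro conjI allI impI)
    fix x assume x: "x \<in> M - (\<Union>i\<in>S. P i)"
    have "\<not> (\<forall>t>0. \<exists>u\<in>(\<Union>i\<in>S. P i). d x u < t)"
    proof
      assume near: "\<forall>t>0. \<exists>u\<in>(\<Union>i\<in>S. P i). d x u < t"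
      have "x \<in> (\<Union>i\<in>S. P i)"
        by (rule limit) (use x near in simp_all)
      with x show False by simp
    qed
    then obtain t where "t > 0" "\<forall>u\<in>(\<Union>i\<in>S. P i). \<not> d x u < t"
      by blast
    then show "\<exists>t>0. disjnt (\<Union>i\<in>S. P i) (mball x t)"
      by (intro exI[of _ t]) (auto simp: disjnt_iff)
  qed (rule sub)
  then show ?thesis
    by (simp add: P_def)
qed

text \<open>
  Since each \<^term>\<open>U i\<close> is open, every point choosing an index in \<^term>\<open>S\<close> appears in one of the
  closed unions above once the radius \<open>1/(n+1)\<close> is small enough.
\<close>
lemma fsigma_in_minim_vimage:
  assumes "metrizable_space X" and "well_order_on I r"
    and U: "\<And>i. i \<in> I \<Longrightarrow> openin X (U i)"
  shows "fsigma_in X {x \<in> (\<Union>i\<in>I. U i). wo_rel.minim r {i \<in> I. x \<in> U i} \<in> S}"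
proof -
  obtain M d where "Metric_space M d" and X: "X = Metric_space.mtopology M d"
    using assms(1) unfolding metrizable_space_def by blast
  interpret Metric_space M d by fact
  interpret wo_rel r
    using assms(2) well_order_on_Well_order unfolding wo_rel_def by blast
  have I: "I = Field r"
    using assms(2) well_order_on_Field by blast
  define h where "h = (\<lambda>x. minim {i \<in> I. x \<in> U i})"
  have h: "h x \<in> I" "x \<in> U (h x)" if "x \<in> U i" "i \<in> I" for x i
    using minim_in[of "{i \<in> I. x \<in> U i}"] that by (auto simp: h_def I)
  have least: "(h x, j) \<in> r" if "x \<in> U j" "j \<in> I" for x j
    using minim_least[of "{i \<in> I. x \<in> U i}" j] that by (auto simp: h_def I)
  define P where "P = (\<lambda>n i. {x \<in> M. mball x (inverse (Suc n)) \<subseteq> U i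
                                  \<and> (\<forall>j\<in>I. x \<in> U j \<longrightarrow> (i, j) \<in> r)})"
  have eq: "{x \<in> (\<Union>i\<in>I. U i). h x \<in> S} = (\<Union>n. \<Union>i\<in>S \<inter> I. P n i)"
  proof (intro equalityI subsetI)
    fix x assume "x \<in> {x \<in> (\<Union>i\<in>I. U i). h x \<in> S}"
    then obtain i where i: "i \<in> I" "x \<in> U i" "h x \<in> S" by blast
    note hx = h[OF i(2,1)]
    obtain t where t: "t > 0" "mball x t \<subseteq> U (h x)"
      using U[OF hx(1)] hx(2) unfolding X openin_mtopology by blast
    obtain n where "inverse (Suc n) < t"
      using reals_Archimedean \<open>t > 0\<close> by blast
    with t(2) have "mball x (inverse (Suc n)) \<subseteq> U (h x)"
      using mball_subset_concentric[of "inverse (Suc n)" t x] by auto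
    moreover have "x \<in> M"
      using U[OF hx(1)] hx(2) unfolding X openin_mtopology by blast
    ultimately have "x \<in> P n (h x)"
      using least unfolding P_def by blast
    then show "x \<in> (\<Union>n. \<Union>i\<in>S \<inter> I. P n i)"
      using hx(1) i(3) by blast
  next
    fix x assume "x \<in> (\<Union>n. \<Union>i\<in>S \<inter> I. P n i)"
    then obtain n i where x: "i \<in> S" "i \<in> I" "x \<in> M" "mball x (inverse (Suc n)) \<subseteq> U i"
        "\<And>j. j \<in> I \<Longrightarrow> x \<in> U j \<Longrightarrow> (i, j) \<in> r"
      by (auto simp: P_def)
    then have "x \<in> U i"
      using centre_in_mball_iff[of x "inverse (Suc n)"] by auto
    then have "h x = i"
      using x h least antisymD[OF ANTISYM] by metis
    with \<open>x \<in> U i\<close> x show "x \<in> {x \<in> (\<Union>i\<in>I. U i). h x \<in> S}" by auto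
  qed
  have "closedin X (\<Union>i\<in>S \<inter> I. P n i)" for n
    unfolding P_def X using closedin_Union_minimal_index_core[of r I U] ANTISYM U X by auto
  then have "fsigma_in X (\<Union>n. \<Union>i\<in>S \<inter> I. P n i)"
    by (intro fsigma_in_Union) (auto intro: closed_imp_fsigma_in)
  then show ?thesis
    unfolding eq[symmetric] by (simp add: h_def)
qed

section \<open>Uniform limits\<close>

text \<open>
  If \<open>G\<close> is the limit, then \<open>G x \<in> V\<close> holds exactly when some ball about \<open>g n x\<close>, large enough to
  contain \<open>G x\<close> and small for large \<open>n\<close>, is inside \<^term>\<open>V\<close>. For fixed \<open>n\<close> this condition on \<open>x\<close>
  is a preimage under \<open>g n\<close>, of a set without any topological structure; this is where
  the hypothesis on preimages of arbitrary sets is used.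
\<close>
lemma (in Metric_space) lebesgue_class_one_map_uniform_limit:
  assumes "mcomplete"
    and gM: "\<And>n x. x \<in> topspace X \<Longrightarrow> g n x \<in> M"
    and fsigma: "\<And>n S. fsigma_in X {x \<in> topspace X. g n x \<in> S}"
    and cauchy: "\<And>m n x. x \<in> topspace X \<Longrightarrow> n \<le> m \<Longrightarrow> d (g n x) (g m x) < \<epsilon> n"
    and eps: "\<epsilon> \<longlonglongrightarrow> 0"
  shows "\<exists>G. lebesgue_class_one_map X mtopology G
    \<and> (\<forall>x\<in>topspace X. limitin mtopology (\<lambda>n. g n x) (G x) sequentially)"
proof -
  have "\<exists>l. limitin mtopology (\<lambda>n. g n x) l sequentially" if x: "x \<in> topspace X" for x
  proof -
    have "MCauchy (\<lambda>n. g n x)"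
      unfolding MCauchy_def
    proof (intro conjI allI impI)
      show "range (\<lambda>n. g n x) \<subseteq> M"
        using gM[OF x] by blast
      fix e :: real assume "e > 0"
      then have "eventually (\<lambda>n. \<epsilon> n < e / 2) sequentially"
        using order_tendstoD(2)[OF eps, of "e / 2"] by simp
      then obtain N where N: "\<epsilon> N < e / 2"
        unfolding eventually_sequentially by blast
      have "d (g n x) (g m x) < e" if "N \<le> n" "N \<le> m" for n m
        using triangle''[of "g n x" "g N x" "g m x"] cauchy[OF x that(1)] cauchy[OF x that(2)]
          N gM[OF x] by (smt (verit) commute field_sum_of_halves)
      then show "\<exists>N. \<forall>n n'. N \<le> n \<longrightarrow> N \<le> n' \<longrightarrow> d (g n x) (g n' x) < e" by blast
    qed
    with \<open>mcomplete\<close> show ?thesis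
      unfolding mcomplete_def by blast
  qed
  then obtain G
    where G: "\<And>x. x \<in> topspace X \<Longrightarrow> limitin mtopology (\<lambda>n. g n x) (G x) sequentially"
    by metis
  have GM: "G x \<in> M" if "x \<in> topspace X" for x
    using G[OF that] by (simp add: limitin_metric)
  have pos: "0 < \<epsilon> n" if "x \<in> topspace X" for n x
    using cauchy[OF that order_refl, of n] gM[OF that] by simp
  have close: "d (g n x) (G x) < 2 * \<epsilon> n" if x: "x \<in> topspace X" for n x
  proof -
    obtain N where N: "\<And>m. m \<ge> N \<Longrightarrow> d (g m x) (G x) < \<epsilon> n"
      using G[OF x] pos[OF x, of n] unfolding limit_metric_sequentially by blast
    define m where "m = max n N"
    have "d (g n x) (G x) \<le> d (g n x) (g m x) + d (g m x) (G x)"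
      using x by (intro triangle gM GM)
    also have "\<dots> < 2 * \<epsilon> n"
      using cauchy[OF x, of n m] N[of m] by (simp add: m_def)
    finally show ?thesis .
  qed
  have "lebesgue_class_one_map X mtopology G"
    unfolding lebesgue_class_one_map_def
  proof (intro conjI allI impI)
    show "G \<in> topspace X \<rightarrow> topspace mtopology"
      using GM by simp
    fix V assume V: "openin mtopology V"
    have "{x \<in> topspace X. G x \<in> V}
        = (\<Union>n. {x \<in> topspace X. g n x \<in> {z. mball z (2 * \<epsilon> n) \<subseteq> V}})"
    proof (intro equalityI subsetI)
      fix x assume "x \<in> {x \<in> topspace X. G x \<in> V}"
      then have x: "x \<in> topspace X" "G x \<in> V" by auto
      obtain t where t: "t > 0" "mball (G x) t \<subseteq> V"
        using V x(2) unfolding openin_mtopology by blast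
      have "eventually (\<lambda>n. \<epsilon> n < t / 4) sequentially"
        using order_tendstoD(2)[OF eps, of "t / 4"] \<open>t > 0\<close> by simp
      then obtain n where n: "\<epsilon> n < t / 4"
        unfolding eventually_sequentially by blast
      have "mball (g n x) (2 * \<epsilon> n) \<subseteq> mball (G x) t"
        using close[OF x(1), of n] n gM[OF x(1), of n] GM[OF x(1)]
        by (intro mball_subset) (auto simp: commute)
      with t x show "x \<in> (\<Union>n. {x \<in> topspace X. g n x \<in> {z. mball z (2 * \<epsilon> n) \<subseteq> V}})"
        by blast
    next
      fix x assume "x \<in> (\<Union>n. {x \<in> topspace X. g n x \<in> {z. mball z (2 * \<epsilon> n) \<subseteq> V}})"
      then obtain n where x: "x \<in> topspace X" "mball (g n x) (2 * \<epsilon> n) \<subseteq> V" by auto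
      have "G x \<in> mball (g n x) (2 * \<epsilon> n)"
        using close[OF x(1)] gM[OF x(1)] GM[OF x(1)] by simp
      with x show "x \<in> {x \<in> topspace X. G x \<in> V}" by blast
    qed
    moreover have "fsigma_in X (\<Union>n. {x \<in> topspace X. g n x \<in> {z. mball z (2 * \<epsilon> n) \<subseteq> V}})"
      by (intro fsigma_in_Union) (auto simp only: fsigma)
    ultimately show "fsigma_in X {x \<in> topspace X. G x \<in> V}" by simp
  qed
  with G show ?thesis by blast
qed

section \<open>Extending a continuous map\<close>

theorem corollary3p4:
  fixes X :: "'a topology" and Y :: "'b topology" and A :: "'a set" and f :: "'a \<Rightarrow> 'b"
  assumes "metrizable_space X"
    and "completely_metrizable_space Y"
    and "topspace Y = {} \<Longrightarrow> topspace X = {}"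
    and "A \<subseteq> topspace X"
    and "continuous_map (subtopology X A) Y f"
  shows "\<exists>g. lebesgue_class_one_map X Y g \<and> (\<forall>x\<in>A. g x = f x)"
proof (cases "topspace X = {}")
  case True
  then show ?thesis
    using assms(4) by (auto simp: lebesgue_class_one_map_def)
next
  case False
  obtain M d where "Metric_space M d" and complete: "Metric_space.mcomplete M d"
    and Y: "Y = Metric_space.mtopology M d"
    using assms(2) unfolding completely_metrizable_space_def by blast
  interpret Metric_space M d by fact
  obtain y0 where y0: "y0 \<in> M"
    using False assms(3) Y by auto
  obtain r where r: "well_order_on M r"
    using well_order_on by blast
  interpret wo_rel r
    using r well_order_on_Well_order unfolding wo_rel_def by blast
  have M: "M = Field r"
    using r well_order_on_Field by blast
  have fM: "f a \<in> M" if "a \<in> A" for a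
    using assms(4,5) that unfolding Y continuous_map_def by auto

  define \<epsilon> :: "nat \<Rightarrow> real" where "\<epsilon> = (\<lambda>n. inverse (Suc n))"
  have eps_pos: "0 < \<epsilon> n" for n
    by (simp add: \<epsilon>_def)
  have eps_antimono: "\<epsilon> m \<le> \<epsilon> n" if "n \<le> m" for m n
    using that by (simp add: \<epsilon>_def)
  have eps_lim: "\<epsilon> \<longlonglongrightarrow> 0"
    unfolding \<epsilon>_def by (rule LIMSEQ_inverse_real_of_nat)

  define U where "U = (\<lambda>n y. \<Union>{W. openin X W \<and> f ` (W \<inter> A) \<subseteq> mball y (\<epsilon> n)})"
  define D where "D = (\<lambda>n. \<Union>y\<in>M. U n y)"
  define h where "h = (\<lambda>n x. minim {y \<in> M. x \<in> U n y})"
  have U_open: "openin X (U n y)" for n y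
    unfolding U_def by blast
  have D_open: "openin X (D n)" for n
    unfolding D_def using U_open by blast
  have h: "h n x \<in> M" "x \<in> U n (h n x)" if "x \<in> D n" for n x
    using minim_in[of "{y \<in> M. x \<in> U n y}"] that by (auto simp: h_def D_def M)
  have D_antimono: "D m \<subseteq> D n" if "n \<le> m" for m n
  proof -
    have "mball y (\<epsilon> m) \<subseteq> mball y (\<epsilon> n)" for y
      using that by (intro mball_subset_concentric eps_antimono)
    then have "U m y \<subseteq> U n y" for y
      unfolding U_def by (intro Union_mono Collect_mono) (meson order_trans)
    then show ?thesis
      unfolding D_def by (rule UN_mono[OF order_refl])
  qed
  have A_D: "a \<in> D n" if a: "a \<in> A" for a n
  proof -
    have "openin (subtopology X A) {x \<in> topspace (subtopology X A). f x \<in> mball (f a) (\<epsilon> n)}"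
      using assms(5) unfolding Y by (intro openin_continuous_map_preimage) auto
    then obtain W where W: "openin X W"
        "{x \<in> topspace (subtopology X A). f x \<in> mball (f a) (\<epsilon> n)} = W \<inter> A"
      unfolding openin_subtopology by blast
    have "a \<in> W"
      using W(2) a assms(4) fM[OF a] eps_pos[of n] by auto
    then have "a \<in> U n (f a)"
      using W unfolding U_def by blast
    then show ?thesis
      using fM[OF a] unfolding D_def by blast
  qed
  have h_f: "d (h n a) (f a) < \<epsilon> n" if a: "a \<in> A" for n a
  proof -
    obtain W where "a \<in> W" "f ` (W \<inter> A) \<subseteq> mball (h n a) (\<epsilon> n)"
      using h(2)[OF A_D[OF a]] unfolding U_def by blast
    with a have "f a \<in> mball (h n a) (\<epsilon> n)"
      by blast
    then show ?thesis by simp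
  qed
  have h_h: "d (h n x) (h m x) < \<epsilon> n + \<epsilon> m" if x: "x \<in> D n" "x \<in> D m" for n m x
  proof -
    obtain W where W: "openin X W" "x \<in> W" "f ` (W \<inter> A) \<subseteq> mball (h n x) (\<epsilon> n)"
      using h(2)[OF x(1)] unfolding U_def by blast
    obtain W' where W': "openin X W'" "x \<in> W'" "f ` (W' \<inter> A) \<subseteq> mball (h m x) (\<epsilon> m)"
      using h(2)[OF x(2)] unfolding U_def by blast
    show ?thesis
    proof (cases "W \<inter> W' \<inter> A = {}")
      case True
      \<comment> \<open>Near \<open>x\<close> there is nothing to approximate: every point of \<open>Y\<close> is a candidate for
         every radius, so both minima are the least element of \<open>Y\<close>.\<close>
      have "x \<in> U k y" for k y
        unfolding U_def
        by (rule UnionI[of "W \<inter> W'"]) (use W W' True in auto)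
      then have "h n x = h m x"
        by (simp add: h_def)
      then show ?thesis
        using h(1)[OF x(2)] eps_pos[of n] eps_pos[of m] by simp
    next
      case False
      then obtain a where "a \<in> W" "a \<in> W'" "a \<in> A" by blast
      then have "d (h n x) (f a) < \<epsilon> n" "d (h m x) (f a) < \<epsilon> m"
        using W W' by auto
      then show ?thesis
        using triangle'[of "h n x" "f a" "h m x"] h(1)[OF x(1)] h(1)[OF x(2)] fM[OF \<open>a \<in> A\<close>]
        by linarith
    qed
  qed

  define g where "g = rec_nat (\<lambda>x. if x \<in> D 0 then h 0 x else y0)
                              (\<lambda>n gn x. if x \<in> D (Suc n) then h (Suc n) x else gn x)"
  have g_0: "g 0 x = (if x \<in> D 0 then h 0 x else y0)" for x
    by (simp add: g_def)
  have g_Suc: "g (Suc n) x = (if x \<in> D (Suc n) then h (Suc n) x else g n x)" for n x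
    by (simp add: g_def)
  have g_D: "g n x = h n x" if "x \<in> D n" for n x
    using that by (cases n) (auto simp: g_0 g_Suc)
  have gM: "g n x \<in> M" for n x
    by (induction n) (auto simp: g_0 g_Suc h y0)
  \<comment> \<open>Whenever \<open>g\<close> changes at stage \<open>m\<close>, the point lies in \<open>D m \<subseteq> D n\<close>, so the new value can be
     compared with \<open>h n x\<close> directly, without summing the errors of the stages in between.\<close>
  have g_g: "d (g n x) (g m x) < 2 * \<epsilon> n" if "n \<le> m" for n m x
    using that
  proof (induction m rule: dec_induct)
    case base
    then show ?case
      using gM eps_pos[of n] by simp
  next
    case (step m)
    show ?case
    proof (cases "x \<in> D (Suc m)")
      case True
      with step have "x \<in> D n"
        using D_antimono[of n "Suc m"] by auto
      with True show ?thesis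
        using h_h[of x n "Suc m"] eps_antimono[of n "Suc m"] step by (simp add: g_D)
    next
      case False
      with step show ?thesis by (simp add: g_Suc)
    qed
  qed
  have fsigma_h: "fsigma_in X {x \<in> D n. h n x \<in> S}" for n S
    unfolding D_def h_def using fsigma_in_minim_vimage[OF assms(1) r U_open] .
  have fsigma_outside: "fsigma_in X (topspace X - D n)" for n
    using D_open by (intro closed_imp_fsigma_in) blast
  have fsigma_g: "fsigma_in X {x \<in> topspace X. g n x \<in> S}" for n S
  proof (induction n)
    case 0
    have "{x \<in> topspace X. g 0 x \<in> S}
        = {x \<in> D 0. h 0 x \<in> S} \<union> (if y0 \<in> S then topspace X - D 0 else {})"
      using openin_subset[OF D_open[of 0]] by (auto simp: g_0 split: if_splits)
    then show ?case
      using fsigma_h fsigma_outside by (auto intro: fsigma_in_Un)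
  next
    case (Suc n)
    have "{x \<in> topspace X. g (Suc n) x \<in> S} = {x \<in> D (Suc n). h (Suc n) x \<in> S}
        \<union> (topspace X - D (Suc n)) \<inter> {x \<in> topspace X. g n x \<in> S}"
      using openin_subset[OF D_open[of "Suc n"]] by (auto simp: g_Suc split: if_splits)
    then show ?case
      by (simp only: fsigma_in_Un fsigma_in_Int fsigma_h fsigma_outside Suc)
  qed

  have "(\<lambda>n. 2 * \<epsilon> n) \<longlonglongrightarrow> 0"
    using tendsto_mult_right_zero[OF eps_lim] .
  from lebesgue_class_one_map_uniform_limit[OF complete gM fsigma_g g_g this]
  obtain G where G: "lebesgue_class_one_map X mtopology G"
    and lim: "\<forall>x\<in>topspace X. limitin mtopology (\<lambda>n. g n x) (G x) sequentially"
    by blast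
  have "G a = f a" if a: "a \<in> A" for a
  proof -
    have "limitin mtopology (\<lambda>n. g n a) (f a) sequentially"
      unfolding limitin_metric
    proof (intro conjI allI impI)
      fix e :: real assume "e > 0"
      then have "eventually (\<lambda>n. \<epsilon> n < e) sequentially"
        using order_tendstoD(2)[OF eps_lim] by simp
      then show "eventually (\<lambda>n. g n a \<in> M \<and> d (g n a) (f a) < e) sequentially"
      proof eventually_elim
        case (elim n)
        then show ?case
          using h_f[OF a, of n] gM[of n a] g_D[OF A_D[OF a], of n] by simp
      qed
    qed (rule fM[OF a])
    moreover have "limitin mtopology (\<lambda>n. g n a) (G a) sequentially"
      using lim a assms(4) by blast
    ultimately show ?thesis
      using limitin_metric_unique trivial_limit_sequentially by metis
  qed
  with G Y show ?thesis by blast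
qed

end
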